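(* Let $n$ be a non-negative integer, and let $(X,\omega)$ and $(X\oplus\mathbb R^n,\tilde\omega)$ be two real symplectic Banach spaces. Assume that $L_{\tilde\omega|_X}-L_\omega:X\to X^*$ is compact, where $\tilde\omega|_X$ is the restriction of $\tilde\omega$ to $X\times X$. Then $(X,\omega)$ is a strong symplectic Banach space if and only if $(X\oplus\mathbb R^n,\tilde\omega)$ is a strong symplectic Banach space. In the affirmative case, $n$ is even.
   Context: A real symplectic Banach space $(X,\omega)$ is a real Banach space $X$ with a bounded bilinear form $\omega:X\times X\to\mathbb R$ that is skew symmetric ($\omega(y,x)=-\omega(x,y)$) and non-degenerate ($\omega(x,y)=0$ for all $x\in X$ implies $y=0$). For a bounded bilinear form $\omega$ on $X$, $L_\omega:X\to X^*$ is $(L_\omega x)(y)=\omega(x,y)$. $(X,\omega)$ is strong if $L_\omega$ is bijective with bounded inverse $X^*\to X$. $X\oplus\mathbb R^n$ carries the product Banach space structure. *)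

theory Defs
  imports "HOL-Analysis.Analysis" "HOL-Library.Type_Length"
begin

text \<open>
  The Euclidean space of dimension LENGTH('n), as functions on the naturals vanishing
  from index LENGTH('n) on.  Unlike \<^typ>\<open>real ^ 'n\<close>, whose index type is
  never empty, this includes the zero-dimensional space: LENGTH(0) = 0.
\<close>

typedef (overloaded) 'n rvec = "{v :: nat \<Rightarrow> real. \<forall>i \<ge> LENGTH('n::len0). v i = 0}"
  morphisms coord Rvec
  by (intro exI[of _ "\<lambda>_. 0"]) simp

setup_lifting type_definition_rvec

instantiation rvec :: (len0) real_vector
begin

lift_definition zero_rvec :: "'a rvec" is "\<lambda>_. 0" by simp
lift_definition plus_rvec :: "'a rvec \<Rightarrow> 'a rvec \<Rightarrow> 'a rvec" is "\<lambda>u v i. u i + v i" by simp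
lift_definition minus_rvec :: "'a rvec \<Rightarrow> 'a rvec \<Rightarrow> 'a rvec" is "\<lambda>u v i. u i - v i" by simp
lift_definition uminus_rvec :: "'a rvec \<Rightarrow> 'a rvec" is "\<lambda>u i. - u i" by simp
lift_definition scaleR_rvec :: "real \<Rightarrow> 'a rvec \<Rightarrow> 'a rvec" is "\<lambda>c u i. c * u i" by simp

instance
  by (standard; transfer; simp add: fun_eq_iff algebra_simps)

end

lemma coord_eq_0: "LENGTH('n) \<le> i \<Longrightarrow> coord (v :: 'n::len0 rvec) i = 0"
  using coord[of v] by simp

instantiation rvec :: (len0) real_normed_vector
begin

definition norm_rvec :: "'a rvec \<Rightarrow> real"
  where "norm_rvec v = L2_set (coord v) {..<LENGTH('a)}"

definition sgn_rvec :: "'a rvec \<Rightarrow> 'a rvec"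
  where "sgn_rvec v = v /\<^sub>R norm v"

definition dist_rvec :: "'a rvec \<Rightarrow> 'a rvec \<Rightarrow> real"
  where "dist_rvec u v = norm (u - v)"

definition uniformity_rvec :: "('a rvec \<times> 'a rvec) filter"
  where "uniformity_rvec = (INF e\<in>{0<..}. principal {(u, v). dist u v < e})"

definition open_rvec :: "'a rvec set \<Rightarrow> bool"
  where "open_rvec U \<longleftrightarrow> (\<forall>u\<in>U. \<forall>\<^sub>F (u', v) in uniformity. u' = u \<longrightarrow> v \<in> U)"

instance
proof
  fix u v :: "'a rvec" and c :: real and U :: "'a rvec set"
  show "dist u v = norm (u - v)" by (rule dist_rvec_def)
  show "sgn u = u /\<^sub>R norm u" by (rule sgn_rvec_def)
  show "uniformity = (INF e\<in>{0<..}. principal {(u, v :: 'a rvec). dist u v < e})"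
    by (rule uniformity_rvec_def)
  show "open U \<longleftrightarrow> (\<forall>u\<in>U. \<forall>\<^sub>F (u', v) in uniformity. u' = u \<longrightarrow> v \<in> U)"
    by (rule open_rvec_def)
  have "u = 0" if "\<forall>i<LENGTH('a). coord u i = 0"
  proof -
    have "coord u i = coord 0 i" for i
      using that coord_eq_0[of i u] by (cases "i < LENGTH('a)") (auto simp: zero_rvec.rep_eq)
    then show ?thesis by (metis coord_inject ext)
  qed
  then show "norm u = 0 \<longleftrightarrow> u = 0"
    by (auto simp: norm_rvec_def L2_set_eq_0_iff zero_rvec.rep_eq)
  show "norm (u + v) \<le> norm u + norm v"
    by (simp add: norm_rvec_def plus_rvec.rep_eq L2_set_triangle_ineq)
  show "norm (c *\<^sub>R u) = \<bar>c\<bar> * norm u"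
    by (simp add: norm_rvec_def scaleR_rvec.rep_eq L2_set_def power_mult_distrib
        sum_distrib_left[symmetric] real_sqrt_mult)
qed

end

lemma abs_coord_le_norm: "\<bar>coord v i\<bar> \<le> norm (v :: 'n::len0 rvec)"
proof (cases "i < LENGTH('n)")
  case True
  have "\<bar>coord v i\<bar> = L2_set (coord v) {i}" by simp
  also have "\<dots> \<le> L2_set (coord v) {..<LENGTH('n)}"
    unfolding L2_set_def using True by (intro real_sqrt_le_mono sum_mono2) auto
  finally show ?thesis by (simp add: norm_rvec_def)
qed (simp add: coord_eq_0)

instance rvec :: (len0) banach
proof
  fix X :: "nat \<Rightarrow> 'a rvec"
  assume X: "Cauchy X"
  have "Cauchy (\<lambda>k. coord (X k) i)" for i
  proof (rule metric_CauchyI)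
    fix e :: real assume "0 < e"
    then obtain M where M: "\<forall>m\<ge>M. \<forall>n\<ge>M. dist (X m) (X n) < e"
      using metric_CauchyD[OF X] by blast
    have "dist (coord (X m) i) (coord (X n) i) \<le> dist (X m) (X n)" for m n
      using abs_coord_le_norm[of "X m - X n" i]
      by (simp add: dist_rvec_def dist_real_def minus_rvec.rep_eq)
    then show "\<exists>M. \<forall>m\<ge>M. \<forall>n\<ge>M. dist (coord (X m) i) (coord (X n) i) < e"
      using M by (meson le_less_trans)
  qed
  then have "\<exists>l. (\<lambda>k. coord (X k) i) \<longlonglongrightarrow> l" for i
    using Cauchy_convergent convergent_def by blast
  then obtain l where l: "\<And>i. (\<lambda>k. coord (X k) i) \<longlonglongrightarrow> l i"
    by metis
  have "l i = 0" if "LENGTH('a) \<le> i" for i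
    using l[of i] that by (simp add: coord_eq_0 LIMSEQ_const_iff)
  then have L: "coord (Rvec l :: 'a rvec) = l"
    by (intro Rvec_inverse) simp
  have "(\<lambda>k. L2_set (\<lambda>i. coord (X k) i - l i) {..<LENGTH('a)}) \<longlonglongrightarrow>
        L2_set (\<lambda>i. l i - l i) {..<LENGTH('a)}"
    unfolding L2_set_def by (intro tendsto_intros l)
  then have "X \<longlonglongrightarrow> Rvec l"
    by (subst tendsto_dist_iff) (simp add: dist_rvec_def norm_rvec_def minus_rvec.rep_eq L L2_set_def)
  then show "convergent X" by (rule convergentI)
qed

definition symplectic :: "('a::banach \<Rightarrow> 'a \<Rightarrow> real) \<Rightarrow> bool" where
  "symplectic \<omega> \<longleftrightarrow>
     bounded_bilinear \<omega> \<and>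
     (\<forall>x y. \<omega> y x = - \<omega> x y) \<and>
     (\<forall>y. (\<forall>x. \<omega> x y = 0) \<longrightarrow> y = 0)"

text \<open>For a bounded bilinear form, each \<open>\<omega> x\<close> is a bounded functional, so that
  \<^const>\<open>Blinfun\<close> is applied within its domain.\<close>

definition L_form :: "('a::real_normed_vector \<Rightarrow> 'a \<Rightarrow> real) \<Rightarrow> 'a \<Rightarrow> 'a \<Rightarrow>\<^sub>L real" where
  "L_form \<omega> x = Blinfun (\<omega> x)"

lemma L_form_apply: "bounded_bilinear \<omega> \<Longrightarrow> blinfun_apply (L_form \<omega> x) y = \<omega> x y"
  unfolding L_form_def
  by (subst bounded_linear_Blinfun_apply) (auto intro: bounded_bilinear.bounded_linear_right)

definition strong_symplectic :: "('a::banach \<Rightarrow> 'a \<Rightarrow> real) \<Rightarrow> bool" where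
  "strong_symplectic \<omega> \<longleftrightarrow>
     symplectic \<omega> \<and> bij (L_form \<omega>) \<and> bounded_linear (inv (L_form \<omega>))"

definition compact_operator :: "('a::real_normed_vector \<Rightarrow> 'b::real_normed_vector) \<Rightarrow> bool" where
  "compact_operator T \<longleftrightarrow>
     bounded_linear T \<and> (\<forall>S. bounded S \<longrightarrow> compact (closure (T ` S)))"

definition restrict_form ::
  "('a \<times> 'b::zero \<Rightarrow> 'a \<times> 'b \<Rightarrow> real) \<Rightarrow> 'a \<Rightarrow> 'a \<Rightarrow> real" where
  "restrict_form \<omega> x y = \<omega> (x, 0) (y, 0)"

end

theory Submission
  imports Defs
begin

text \<open>
  Compare \<open>\<omega>'\<close> with the direct sum \<open>\<eta>\<close> of \<open>\<omega>\<close> and the Euclidean inner product.  Both forms are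
  nondegenerate, \<open>L\<^sub>\<omega>\<^sub>' - L\<^sub>\<eta>\<close> is compact, and \<open>L\<^sub>\<eta>\<close> is invertible iff \<open>L\<^sub>\<omega>\<close> is; so both directions of the
  equivalence are instances of the Fredholm alternative (an injective compact perturbation of an
  isomorphism is an isomorphism).

  For the parity, replace the inner product by \<open>0\<close>: the sum \<open>\<omega>\<^sub>0\<close> is skew with kernel \<open>\<real>\<^sup>n\<close>, and
  \<open>T = L\<^sub>\<omega>\<^sub>'\<inverse> L\<^sub>\<omega>\<^sub>0\<close> is the identity plus a compact operator and self-adjoint for \<open>\<omega>'\<close>.  By Riesz theory,
  the range of \<open>T\<^sup>N\<close> stabilizes, whence the whole space is the sum of this range and \<open>E = ker T\<^sup>N\<close>, which
  are \<open>\<omega>'\<close>-orthogonal.  Thus \<open>\<omega>'\<close> is nondegenerate on the finite-dimensional space \<open>E\<close>, and \<open>\<omega>\<^sub>0\<close> is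
  nondegenerate on any complement of \<open>ker T\<close> in \<open>E\<close>.  Nondegenerate skew forms live in even dimension, so
  \<open>n = dim ker T\<close> is a difference of even numbers.
\<close>

section \<open>Compact operators in terms of sequences\<close>

text \<open>Sequential form of compactness: sums and compositions are then handled by passing to
  subsequences.\<close>

definition completely_continuous :: "('a::real_normed_vector \<Rightarrow> 'b::real_normed_vector) \<Rightarrow> bool" where
  "completely_continuous K \<longleftrightarrow> bounded_linear K \<and>
     (\<forall>x :: nat \<Rightarrow> 'a. bounded (range x) \<longrightarrow> (\<exists>r. strict_mono r \<and> convergent (\<lambda>n. K (x (r n)))))"

lemma completely_continuousD:
  assumes "completely_continuous K" "\<And>n :: nat. norm (x n) \<le> B"
  obtains r l where "strict_mono r" "(\<lambda>n. K (x (r n))) \<longlonglongrightarrow> l"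
proof -
  have "bounded (range x)" using assms(2) by (auto simp: bounded_iff)
  then show ?thesis using assms(1) that unfolding completely_continuous_def convergent_def by blast
qed

lemma compact_operator_imp_completely_continuous:
  assumes "compact_operator K"
  shows "completely_continuous K"
  unfolding completely_continuous_def
proof (intro conjI allI impI)
  show "bounded_linear K" using assms by (simp add: compact_operator_def)
next
  fix x :: "nat \<Rightarrow> 'a" assume "bounded (range x)"
  then have "seq_compact (closure (K ` range x))"
    using assms by (simp add: compact_operator_def compact_eq_seq_compact_metric)
  moreover have "\<forall>n. K (x n) \<in> closure (K ` range x)"
    using closure_subset by fastforce
  ultimately obtain l r where "strict_mono r" "((\<lambda>n. K (x n)) \<circ> r) \<longlonglongrightarrow> l"
    using seq_compactE[of _ "\<lambda>n. K (x n)"] by blast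
  then show "\<exists>r. strict_mono r \<and> convergent (\<lambda>n. K (x (r n)))"
    unfolding convergent_def comp_def by blast
qed

lemma completely_continuous_add:
  assumes "completely_continuous F" "completely_continuous G"
  shows "completely_continuous (\<lambda>x. F x + G x)"
  unfolding completely_continuous_def
proof (intro conjI allI impI)
  show "bounded_linear (\<lambda>x. F x + G x)"
    using assms by (intro bounded_linear_add) (auto simp: completely_continuous_def)
next
  fix x :: "nat \<Rightarrow> 'a" assume x: "bounded (range x)"
  then obtain r where r: "strict_mono r" "convergent (\<lambda>n. F (x (r n)))"
    using assms(1) unfolding completely_continuous_def by blast
  have "bounded (range (x \<circ> r))" using x by (rule bounded_subset) auto
  then obtain s where s: "strict_mono s" "convergent (\<lambda>n. G (x (r (s n))))"
    using assms(2)[unfolded completely_continuous_def, THEN conjunct2, rule_format, of "x \<circ> r"]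
    by auto
  have "convergent (\<lambda>n. F (x (r (s n))))"
    using convergent_subseq_convergent[OF r(2) s(1)] by (simp add: comp_def)
  then show "\<exists>r. strict_mono r \<and> convergent (\<lambda>n. F (x (r n)) + G (x (r n)))"
    using r(1) s by (intro exI[of _ "r \<circ> s"]) (auto simp: strict_mono_o intro: convergent_add)
qed

lemma completely_continuous_zero: "completely_continuous (\<lambda>_. 0)"
  unfolding completely_continuous_def by (auto simp: convergent_const intro: strict_mono_id)

lemma completely_continuous_sum:
  assumes "\<And>i. i \<in> I \<Longrightarrow> completely_continuous (F i)"
  shows "completely_continuous (\<lambda>x. \<Sum>i\<in>I. F i x)"
  using assms
  by (induction I rule: infinite_finite_induct)
    (simp_all add: completely_continuous_zero completely_continuous_add)

lemma completely_continuous_compose_left: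
  assumes "bounded_linear F" "completely_continuous K"
  shows "completely_continuous (\<lambda>x. F (K x))"
  unfolding completely_continuous_def
proof (intro conjI allI impI)
  show "bounded_linear (\<lambda>x. F (K x))"
    using assms by (intro bounded_linear_compose[of F K]) (auto simp: completely_continuous_def)
next
  fix x :: "nat \<Rightarrow> 'c" assume "bounded (range x)"
  then obtain r where "strict_mono r" "convergent (\<lambda>n. K (x (r n)))"
    using assms(2) unfolding completely_continuous_def by blast
  then show "\<exists>r. strict_mono r \<and> convergent (\<lambda>n. F (K (x (r n))))"
    unfolding convergent_def using bounded_linear.tendsto[OF assms(1)] by blast
qed

lemma completely_continuous_compose_right:
  assumes "completely_continuous K" "bounded_linear F"
  shows "completely_continuous (\<lambda>x. K (F x))"
  unfolding completely_continuous_def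
proof (intro conjI allI impI)
  show "bounded_linear (\<lambda>x. K (F x))"
    using assms by (intro bounded_linear_compose[of K F]) (auto simp: completely_continuous_def)
next
  fix x :: "nat \<Rightarrow> 'c" assume "bounded (range x)"
  then have "bounded (range (\<lambda>n. F (x n)))"
    using bounded_linear_image[OF _ assms(2), of "range x"] by (simp add: image_image)
  then show "\<exists>r. strict_mono r \<and> convergent (\<lambda>n. K (F (x (r n))))"
    using assms(1) unfolding completely_continuous_def by blast
qed

text \<open>Bolzano-Weierstrass for the scalars \<open>f x\<close>; the finite-rank corrections
  below are sums of such terms.\<close>

lemma completely_continuous_rank_one:
  fixes f :: "'a::real_normed_vector \<Rightarrow> real"
  assumes "bounded_linear f"
  shows "completely_continuous (\<lambda>x. f x *\<^sub>R a)"
proof (rule completely_continuous_compose_left[where F = "\<lambda>c. c *\<^sub>R a"])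
  show "bounded_linear (\<lambda>c. c *\<^sub>R a)" by (rule bounded_linear_scaleR_left)
  show "completely_continuous f"
    unfolding completely_continuous_def
  proof (intro conjI assms allI impI)
    fix x :: "nat \<Rightarrow> 'a" assume "bounded (range x)"
    then have "bounded (range (\<lambda>n. f (x n)))"
      using bounded_linear_image[OF _ assms, of "range x"] by (simp add: image_image)
    then show "\<exists>r. strict_mono r \<and> convergent (\<lambda>n. f (x (r n)))"
      using bounded_imp_convergent_subsequence[of "\<lambda>n. f (x n)"]
      unfolding convergent_def comp_def by blast
  qed
qed

section \<open>Riesz theory of the identity plus a compact operator\<close>

lemma bounded_linear_identity_plus_completely_continuous:
  "completely_continuous K \<Longrightarrow> bounded_linear (\<lambda>x. x + K x)"
  unfolding completely_continuous_def by (intro bounded_linear_add bounded_linear_ident) simp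

text \<open>Composing \<open>I + K\<close> with \<open>I + K'\<close> gives
  \<open>I + (K' + K (I + K'))\<close>, again a compact perturbation. Hence closedness of the range
  passes to all powers.\<close>

lemma funpow_identity_plus_completely_continuous:
  assumes K: "completely_continuous K"
  shows "\<exists>K'. completely_continuous K' \<and> (\<lambda>x. x + K x) ^^ k = (\<lambda>x. x + K' x)"
proof (induction k)
  case 0
  then show ?case using completely_continuous_zero by (intro exI[of _ "\<lambda>_. 0"]) (auto simp: fun_eq_iff)
next
  case (Suc k)
  then obtain K' where K': "completely_continuous K'" "(\<lambda>x. x + K x) ^^ k = (\<lambda>x. x + K' x)"
    by blast
  have "bounded_linear (\<lambda>x. x + K' x)"
    using K'(1) by (rule bounded_linear_identity_plus_completely_continuous)
  then have "completely_continuous (\<lambda>x. K' x + K (x + K' x))"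
    by (intro completely_continuous_add K' completely_continuous_compose_right[OF K])
  moreover have "(\<lambda>x. x + K x) ^^ Suc k = (\<lambda>x. x + (K' x + K (x + K' x)))"
    using K'(2) by (auto simp: fun_eq_iff add.assoc)
  ultimately show ?case by blast
qed

text \<open>Since \<open>I + K\<close> may have a kernel, only some preimage can be controlled: the
  map induced on the quotient by the kernel is bounded below. This yields the closed range and, in
  the injective case, a bounded inverse.\<close>

lemma bounded_preimage_identity_plus_completely_continuous:
  assumes K: "completely_continuous K"
  obtains C where "\<And>x. \<exists>z. z + K z = x + K x \<and> norm z \<le> C * norm (x + K x)"
proof (rule ccontr)
  define T where "T = (\<lambda>x. x + K x)"
  have T: "bounded_linear T"
    unfolding T_def by (rule bounded_linear_identity_plus_completely_continuous[OF K])
  interpret T: bounded_linear T by (rule T)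
  assume "\<not> thesis"
  \<comment> \<open>Failure of the bound \<open>C = n\<close> gives a point all of whose preimages,
    itself included, are too long.\<close>
  then have "\<exists>x. \<forall>z. T z = T x \<longrightarrow> norm z > real n * norm (T x)" for n
    using that[of "real n"] unfolding T_def by (meson not_less)
  then obtain x where x: "\<And>n z. T z = T (x n) \<Longrightarrow> norm z > real n * norm (T (x n))"
    by metis
  \<comment> \<open>The distance of \<open>x n\<close> from the kernel of \<open>T\<close>; a near-minimizer \<open>z n\<close>, normalized, subconverges to a
    unit vector in the kernel, which contradicts near-minimality.\<close>
  define m where "m n = (INF z\<in>{z. T z = T (x n)}. norm z)" for n
  have m_le: "m n \<le> norm z" if "T z = T (x n)" for n z
    unfolding m_def using that by (intro cINF_lower bdd_belowI2[of _ 0]) auto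
  obtain B where B: "B > 0" "\<And>x. norm (T x) \<le> norm x * B"
    using T.pos_bounded by blast
  \<comment> \<open>\<open>T (x n)\<close> is nonzero, since otherwise \<open>0\<close> would be a
    preimage violating the choice of \<open>x n\<close>; boundedness of \<open>T\<close> then keeps
    all its preimages away from \<open>0\<close>.\<close>
  have m_pos: "m n > 0" for n
  proof -
    have "T (x n) \<noteq> 0" using x[of 0 n] by (auto simp: T.zero)
    then have "0 < norm (T (x n)) / B" using B by simp
    also have "\<dots> \<le> m n"
      unfolding m_def
    proof (rule cINF_greatest)
      fix z assume "z \<in> {z. T z = T (x n)}"
      then show "norm (T (x n)) / B \<le> norm z"
        using B by (metis mem_Collect_eq pos_divide_le_eq)
    qed auto
    finally show ?thesis .
  qed
  have "\<exists>z. T z = T (x n) \<and> norm z < 2 * m n" for n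
  proof (rule ccontr)
    assume "\<not> ?thesis"
    then have "2 * m n \<le> m n"
      by (subst (2) m_def, intro cINF_greatest) (auto simp: not_less)
    then show False using m_pos[of n] by simp
  qed
  then obtain z where z: "\<And>n. T (z n) = T (x n)" "\<And>n. norm (z n) < 2 * m n"
    by metis
  define w where "w n = z n /\<^sub>R norm (z n)" for n
  have z_pos: "norm (z n) > 0" for n
    using m_le[OF z(1)] m_pos[of n] by (rule less_le_trans[rotated])
  have w_norm: "norm (w n) = 1" for n
    using z_pos[of n] by (simp add: w_def)
  obtain r l where r: "strict_mono r" "(\<lambda>n. K (w (r n))) \<longlonglongrightarrow> l"
    using completely_continuousD[OF K, of w 1] w_norm by auto
  have Tw: "norm (T (w n)) \<le> inverse (real n)" if "n > 0" for n
  proof -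
    have "real n * norm (T (x n)) \<le> norm (z n)"
      using x[OF z(1)] by (rule less_imp_le)
    then show ?thesis
      using z_pos[of n] that by (simp add: w_def T.scaleR z(1) field_simps)
  qed
  have "(\<lambda>n. T (w n)) \<longlonglongrightarrow> 0"
    by (rule Lim_null_comparison[OF eventually_mono[OF eventually_gt_at_top[of 0]] lim_inverse_n])
      (rule Tw)
  then have Tw0: "(\<lambda>n. T (w (r n))) \<longlonglongrightarrow> 0"
    using LIMSEQ_subseq_LIMSEQ[OF _ r(1)] by (auto simp: comp_def)
  \<comment> \<open>Here \<open>w = T w - K w\<close>, so convergence of the two terms on the right
    forces convergence of \<open>w\<close> along \<open>r\<close>.\<close>
  have wl: "(\<lambda>n. w (r n)) \<longlonglongrightarrow> - l"
    using tendsto_diff[OF Tw0 r(2)] by (simp add: T_def)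
  then have "T (- l) = 0"
    using LIMSEQ_unique[OF T.tendsto[OF wl] Tw0] by simp
  then have Tl: "T l = 0" by (simp add: T.neg)
  \<comment> \<open>Adding a multiple of the kernel vector \<open>l\<close> to \<open>z\<close>
    gives another preimage, whose norm is at least \<open>m\<close>, hence more than half the norm
    of \<open>z\<close>.\<close>
  have "1 / 2 < norm (w (r n) + l)" for n
  proof -
    have "m (r n) \<le> norm (z (r n) + norm (z (r n)) *\<^sub>R l)"
      by (rule m_le) (simp add: T.add T.scaleR Tl z(1))
    also have "z (r n) + norm (z (r n)) *\<^sub>R l = norm (z (r n)) *\<^sub>R (w (r n) + l)"
      using z_pos[of "r n"] by (simp add: w_def scaleR_add_right)
    finally have "norm (z (r n)) / 2 < norm (z (r n)) * norm (w (r n) + l)"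
      using z(2)[of "r n"] by simp
    then show ?thesis using z_pos[of "r n"] by (simp add: field_simps)
  qed
  moreover have "(\<lambda>n. norm (w (r n) + l)) \<longlonglongrightarrow> 0"
    using tendsto_norm[OF tendsto_add[OF wl tendsto_const[of l]]] by simp
  then have "\<exists>n. norm (w (r n) + l) < 1 / 2"
    using order_tendstoD(2)[of _ 0 sequentially "1/2"] eventually_sequentially by fastforce
  ultimately show False by (meson less_asym)
qed

text \<open>Bounded preimages \<open>z\<close> of a convergent sequence \<open>y\<close> have a
  subsequence along which \<open>K z\<close> converges; then \<open>z = y - K z\<close> converges
  too, to a preimage of the limit.\<close>

lemma closed_range_identity_plus_completely_continuous:
  assumes K: "completely_continuous K"
  shows "closed (range (\<lambda>x. x + K x))"
  unfolding closed_sequential_limits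
proof (intro allI impI)
  fix y l assume "(\<forall>n :: nat. y n \<in> range (\<lambda>x. x + K x)) \<and> y \<longlonglongrightarrow> l"
  then have y: "\<And>n. \<exists>x. y n = x + K x" and yl: "y \<longlonglongrightarrow> l" by auto
  obtain C where "\<And>x. \<exists>z. z + K z = x + K x \<and> norm z \<le> C * norm (x + K x)"
    using bounded_preimage_identity_plus_completely_continuous[OF K] by blast
  then have "\<exists>z. z + K z = y n \<and> norm z \<le> C * norm (y n)" for n
    using y[of n] by metis
  then obtain z where z: "\<And>n. z n + K (z n) = y n" "\<And>n. norm (z n) \<le> C * norm (y n)"
    by metis
  obtain B where B: "\<And>n. norm (y n) \<le> B"
    using convergent_imp_bounded[OF yl] by (auto simp: bounded_iff)
  have "norm (z n) \<le> \<bar>C\<bar> * B" for n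
    using z(2)[of n] B[of n] by (smt (verit) mult_mono norm_ge_zero)
  then obtain r k where r: "strict_mono r" "(\<lambda>n. K (z (r n))) \<longlonglongrightarrow> k"
    using completely_continuousD[OF K] by metis
  have yr: "(\<lambda>n. y (r n)) \<longlonglongrightarrow> l"
    using LIMSEQ_subseq_LIMSEQ[OF yl r(1)] by (simp add: comp_def)
  have zr: "(\<lambda>n. z (r n)) \<longlonglongrightarrow> l - k"
    using tendsto_diff[OF yr r(2)] by (simp flip: z(1))
  have "(\<lambda>n. K (z (r n))) \<longlonglongrightarrow> K (l - k)"
    using K zr bounded_linear.tendsto unfolding completely_continuous_def by blast
  then have "K (l - k) = k" using r(2) LIMSEQ_unique by blast
  then show "l \<in> range (\<lambda>x. x + K x)"
    by (intro image_eqI[of _ _ "l - k"]) auto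
qed

text \<open>Normalize \<open>a - b\<close>, where \<open>a\<close> lies in \<open>U\<close> but not
  in \<open>S\<close>, and \<open>b\<close> in \<open>S\<close> is closer to \<open>a\<close> than
  twice the distance from \<open>a\<close> to \<open>S\<close>. Closedness of \<open>S\<close> makes
  that distance positive.\<close>

lemma Riesz_almost_orthogonal:
  fixes S U :: "'a::real_normed_vector set"
  assumes "closed S" "subspace S" "subspace U" "S \<subset> U"
  obtains x where "x \<in> U" "norm x = 1" "\<And>y. y \<in> S \<Longrightarrow> 1 / 2 \<le> norm (x - y)"
proof -
  obtain a where a: "a \<in> U" "a \<notin> S" using assms(4) by blast
  have ne: "S \<noteq> {}" using subspace_0[OF assms(2)] by blast
  have d: "infdist a S > 0"
    using in_closed_iff_infdist_zero[OF assms(1) ne] a(2) infdist_nonneg[of a S] by (metis less_le)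
  then have "\<not> (\<forall>b\<in>S. 2 * infdist a S \<le> dist a b)"
    using cINF_greatest[OF ne, of "2 * infdist a S" "dist a"] ne by (auto simp: infdist_def)
  then obtain b where b: "b \<in> S" "dist a b < 2 * infdist a S" by force
  define s where "s = norm (a - b)"
  have s: "s > 0" "s < 2 * infdist a S"
    using infdist_le[OF b(1), of a] d b(2) by (auto simp: s_def dist_norm)
  show thesis
  proof
    show "(a - b) /\<^sub>R s \<in> U"
      using a b assms by (intro subspace_scale subspace_diff) auto
    show "norm ((a - b) /\<^sub>R s) = 1" using s by (simp add: s_def)
    fix y assume "y \<in> S"
    \<comment> \<open>The distance is tested at the point \<open>b + s y\<close> of
      \<open>S\<close>, which undoes the normalization by \<open>s\<close>.\<close>
    then have "infdist a S \<le> dist a (b + s *\<^sub>R y)"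
      using b assms by (intro infdist_le subspace_add subspace_scale)
    also have "a - (b + s *\<^sub>R y) = s *\<^sub>R ((a - b) /\<^sub>R s - y)"
      using s by (simp add: scaleR_diff_right)
    then have "dist a (b + s *\<^sub>R y) = s * norm ((a - b) /\<^sub>R s - y)"
      using s by (simp add: dist_norm)
    finally have "s / 2 < s * norm ((a - b) /\<^sub>R s - y)" using s by linarith
    then show "1 / 2 \<le> norm ((a - b) /\<^sub>R s - y)"
      using s by (simp add: field_simps)
  qed
qed

lemma range_funpow_antimono:
  fixes f :: "'a \<Rightarrow> 'a"
  shows "j \<le> k \<Longrightarrow> range (f ^^ k) \<subseteq> range (f ^^ j)"
  by (auto simp: le_iff_add funpow_add)

lemma bounded_linear_funpow:
  fixes f :: "'a::real_normed_vector \<Rightarrow> 'a"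
  assumes "bounded_linear f"
  shows "bounded_linear (f ^^ k)"
proof (induction k)
  case (Suc k)
  then show ?case using bounded_linear_compose[OF assms] by (simp add: comp_def)
qed (simp add: id_def)

text \<open>If the closed ranges decreased strictly forever, unit vectors \<open>x k\<close> in the
  \<open>k\<close>-th range, almost orthogonal to the next one, would have images under
  \<open>K\<close> at mutual distance at least 1/2, so no subsequence of these images could
  converge.\<close>

lemma range_funpow_stabilizes:
  assumes K: "completely_continuous K"
  obtains N where "range ((\<lambda>x. x + K x) ^^ N) = range ((\<lambda>x. x + K x) ^^ Suc N)"
proof (rule ccontr)
  define T where "T = (\<lambda>x. x + K x)"
  have T: "bounded_linear T"
    unfolding T_def by (rule bounded_linear_identity_plus_completely_continuous[OF K])
  define R where "R k = range (T ^^ k)" for k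
  have anti: "j \<le> k \<Longrightarrow> R k \<subseteq> R j" for j k
    unfolding R_def by (rule range_funpow_antimono)
  assume "\<not> thesis"
  then have proper: "R (Suc k) \<subset> R k" for k
    using anti[of k "Suc k"] that[of k] \<open>\<not> thesis\<close> unfolding R_def T_def by force
  have sub: "subspace (R k)" for k
    unfolding R_def using bounded_linear_funpow[OF T, of k]
    by (intro linear_subspace_image bounded_linear.linear subspace_UNIV)
  have cl: "closed (R k)" for k
    using funpow_identity_plus_completely_continuous[OF K, of k] closed_range_identity_plus_completely_continuous
    unfolding R_def T_def by metis
  have TR: "T x \<in> R (Suc k)" if "x \<in> R k" for x k
    using that by (auto simp: R_def)
  have "\<exists>x. x \<in> R k \<and> norm x = 1 \<and> (\<forall>y\<in>R (Suc k). 1 / 2 \<le> norm (x - y))" for k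
    using Riesz_almost_orthogonal[OF cl sub sub proper] by metis
  then obtain x where x: "\<And>k. x k \<in> R k" "\<And>k. norm (x k) = 1"
      "\<And>k y. y \<in> R (Suc k) \<Longrightarrow> 1 / 2 \<le> norm (x k - y)"
    by metis
  have sep: "1 / 2 \<le> norm (K (x j) - K (x k))" if "j < k" for j k
  proof -
    have "x k \<in> R (Suc j)" "T (x k) \<in> R (Suc j)"
      using x(1)[of k] TR[OF x(1), of k] anti[of "Suc j" k] anti[of "Suc j" "Suc k"] that by auto
    \<comment> \<open>This vector lies one range further down, and its difference from
      \<open>x j\<close> is exactly \<open>K (x k) - K (x j)\<close>.\<close>
    then have "T (x j) - T (x k) + x k \<in> R (Suc j)"
      using TR[OF x(1)] by (intro subspace_add subspace_diff sub)
    then have "1 / 2 \<le> norm (x j - (T (x j) - T (x k) + x k))" by (rule x(3))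
    also have "x j - (T (x j) - T (x k) + x k) = - (K (x j) - K (x k))"
      by (simp add: T_def)
    finally show ?thesis by (simp only: norm_minus_cancel)
  qed
  obtain r l where r: "strict_mono r" "(\<lambda>n. K (x (r n))) \<longlonglongrightarrow> l"
    using completely_continuousD[OF K, of x 1] x(2) by auto
  have "Cauchy (\<lambda>n. K (x (r n)))" using r(2) by (rule LIMSEQ_imp_Cauchy)
  then obtain M where M: "\<And>m n. m \<ge> M \<Longrightarrow> n \<ge> M \<Longrightarrow> norm (K (x (r m)) - K (x (r n))) < 1 / 2"
    using CauchyD[of _ "1 / 2"] by (metis half_gt_zero zero_less_one)
  have "r M < r (Suc M)" using r(1) by (simp add: strict_mono_less)
  then show False using sep M[of M "Suc M"] by fastforce
qed

lemma range_funpow_stable: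
  fixes f :: "'a \<Rightarrow> 'a"
  assumes "range (f ^^ N) = range (f ^^ Suc N)"
  shows "range (f ^^ (N + m)) = range (f ^^ N)"
proof (induction m)
  case (Suc m)
  have "range (f ^^ (N + Suc m)) = f ` range (f ^^ (N + m))"
    by auto
  also have "\<dots> = f ` range (f ^^ N)" by (simp only: Suc)
  also have "\<dots> = range (f ^^ Suc N)" by auto
  finally show ?case by (simp only: assms)
qed simp

text \<open>\<open>T\<close>, the composition of \<open>inv P\<close> with \<open>Q\<close>, is
  injective and the identity plus a compact operator. Stabilization of its ranges makes it
  surjective, and the preimage estimate bounds the inverse.\<close>

lemma Fredholm_alternative:
  fixes P Q :: "'a::real_normed_vector \<Rightarrow> 'b::real_normed_vector"
  assumes P: "bounded_linear P" "bij P" "bounded_linear (inv P)"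
    and Q: "bounded_linear Q" "inj Q"
    and cc: "completely_continuous (\<lambda>x. Q x - P x)"
  shows "bij Q \<and> bounded_linear (inv Q)"
proof -
  define K where "K = (\<lambda>x. inv P (Q x - P x))"
  define T where "T = (\<lambda>x. x + K x)"
  interpret P: bounded_linear P by fact
  interpret Q: bounded_linear Q by fact
  interpret iP: bounded_linear "inv P" by fact
  have K: "completely_continuous K"
    unfolding K_def by (rule completely_continuous_compose_left[OF P(3) cc])
  have T_eq: "T x = inv P (Q x)" for x
    using P(2) by (simp add: T_def K_def iP.diff bij_is_inj inv_f_f)
  have QT: "Q x = P (T x)" for x
    using P(2) by (simp add: T_eq bij_is_surj surj_f_inv_f)
  have inj: "inj T"
    using Q(2) by (auto simp: inj_def QT)
  obtain N where N: "range (T ^^ N) = range (T ^^ Suc N)"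
    using range_funpow_stabilizes[OF K] unfolding T_def by blast
  have "surj T"
    unfolding surj_def
  proof
    fix y
    \<comment> \<open>Stabilization gives \<open>x\<close> with \<open>T^N y = T^N (T x)\<close>,
      and the injective power \<open>T^N\<close> cancels.\<close>
    have "(T ^^ N) y \<in> range (T ^^ Suc N)" using N by blast
    then obtain x where "(T ^^ N) y = (T ^^ Suc N) x" by blast
    then have "(T ^^ N) y = (T ^^ N) (T x)" by (simp add: funpow_swap1)
    moreover have "inj (T ^^ N)" using inj by (induction N) (auto intro: inj_compose)
    ultimately show "\<exists>x. y = T x" by (auto simp: inj_def)
  qed
  have Q_bij: "bij Q"
  proof -
    have "Q = P \<circ> T" by (auto simp: QT)
    then show ?thesis using bij_comp[OF bijI[OF inj \<open>surj T\<close>] P(2)] by simp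
  qed
  moreover obtain C where C: "\<And>x. \<exists>z. z + K z = x + K x \<and> norm z \<le> C * norm (x + K x)"
    using bounded_preimage_identity_plus_completely_continuous[OF K] by blast
  \<comment> \<open>By injectivity the controlled preimage of \<open>T x\<close> is \<open>x\<close>
    itself.\<close>
  have bd: "norm x \<le> C * norm (T x)" for x
    using C[of x] inj unfolding T_def inj_def by metis
  obtain B where B: "\<And>y. norm (inv P y) \<le> norm y * B" using iP.bounded by blast
  have "bounded_linear (inv Q)"
  proof (rule bounded_linear_intro)
    have Qi: "Q (inv Q y) = y" for y using Q_bij by (simp add: bij_is_surj surj_f_inv_f)
    show "inv Q (x + y) = inv Q x + inv Q y" for x y
      using Qi by (intro injD[OF Q(2)]) (simp add: Q.add)
    show "inv Q (c *\<^sub>R x) = c *\<^sub>R inv Q x" for c x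
      using Qi by (intro injD[OF Q(2)]) (simp add: Q.scaleR)
    show "norm (inv Q y) \<le> norm y * (B * \<bar>C\<bar>)" for y
    proof -
      have "norm (inv Q y) \<le> C * norm (inv P y)"
        using bd[of "inv Q y"] by (simp add: T_eq Qi)
      also have "\<dots> \<le> \<bar>C\<bar> * norm (inv P y)" by (intro mult_right_mono) auto
      also have "\<dots> \<le> \<bar>C\<bar> * (norm y * B)" by (intro mult_left_mono B) auto
      finally show ?thesis by (simp add: mult_ac)
    qed
  qed
  ultimately show ?thesis by blast
qed


section \<open>Finite-dimensional linear algebra: skew forms and kernels of powers\<close>

text \<open>\<open>f\<close> plays the role of a Gram matrix, and the last assumption is linear
  independence of its rows. Induction splits off two indices \<open>a\<close>, \<open>b\<close> with
  \<open>f a b\<close> nonzero.\<close>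

lemma even_card_skew_nondegenerate_family:
  fixes f :: "'i \<Rightarrow> 'i \<Rightarrow> real"
  assumes "finite I"
    and "\<And>i j. i \<in> I \<Longrightarrow> j \<in> I \<Longrightarrow> f j i = - f i j"
    and "\<And>c i. (\<And>j. j \<in> I \<Longrightarrow> (\<Sum>i\<in>I. c i * f i j) = 0) \<Longrightarrow> i \<in> I \<Longrightarrow> c i = 0"
  shows "even (card I)"
  using assms
proof (induction "card I" arbitrary: I f rule: less_induct)
  case less
  show ?case
  proof (cases "I = {}")
    case False
    then obtain a where a: "a \<in> I" by blast
    have "\<exists>b\<in>I. f a b \<noteq> 0"
    proof (rule ccontr)
      assume "\<not> ?thesis"
      \<comment> \<open>If row \<open>a\<close> vanished, the indicator of \<open>a\<close> would be
        a nontrivial relation between the rows.\<close>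
      then have "(\<Sum>i\<in>I. of_bool (i = a) * f i j) = 0" if "j \<in> I" for j
        using that by (intro sum.neutral) auto
      then have "of_bool (a = a) = (0 :: real)" by (rule less.prems(3)) (use a in auto)
      then show False by simp
    qed
    then obtain b where b: "b \<in> I" "f a b \<noteq> 0" by blast
    have diag: "f i i = 0" if "i \<in> I" for i using less.prems(2)[of i i] that by simp
    then have ab: "a \<noteq> b" using b a by auto
    define J where "J = I - {a, b}"
    have I: "I = insert a (insert b J)" and J: "a \<notin> J" "b \<notin> J" "finite J"
      using a b less.prems(1) by (auto simp: J_def)
    have card: "card I = card J + 2" using I J ab by simp
    \<comment> \<open>Schur complement: the form on the orthogonal complement of the hyperbolic plane of \<open>a\<close> and \<open>b\<close>.\<close>
    define g where "g i j = f i j + (f i a * f b j - f i b * f a j) / f a b" for i j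
    have "even (card J)"
    proof (rule less.hyps[of J g])
      fix i j assume "i \<in> J" "j \<in> J"
      then show "g j i = - g i j"
        using less.prems(2)[of i j] less.prems(2)[of i a] less.prems(2)[of i b]
          less.prems(2)[of j a] less.prems(2)[of j b] I b(2)
        by (simp add: g_def field_simps)
    next
      fix c i assume c: "\<And>j. j \<in> J \<Longrightarrow> (\<Sum>i\<in>J. c i * g i j) = 0" and i: "i \<in> J"
      define s where "s j = (\<Sum>i\<in>J. c i * f i j)" for j
      \<comment> \<open>The coefficients at \<open>a\<close> and \<open>b\<close> are those that
        make the combined row vanish in the columns \<open>a\<close> and \<open>b\<close>. So a
        relation for \<open>g\<close> on \<open>J\<close> lifts to one for \<open>f\<close> on
        \<open>I\<close>.\<close>
      define c' where "c' = c(a := - s b / f a b, b := s a / f a b)"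
      have "c' i = 0"
      proof (rule less.prems(3))
        fix j assume j: "j \<in> I"
        have "(\<Sum>i\<in>J. c' i * f i j) = s j"
          unfolding s_def using J by (intro sum.cong) (auto simp: c'_def)
        then have "(\<Sum>i\<in>I. c' i * f i j) = s j + (s a * f b j - s b * f a j) / f a b"
          using I J ab by (simp add: c'_def diff_divide_distrib)
        also have "\<dots> = 0"
        proof -
          consider "j = a" | "j = b" | "j \<in> J" using j I by blast
          then show ?thesis
          proof cases
            case 1
            then show ?thesis using diag[OF a] less.prems(2)[OF a b(1)] b(2) by simp
          next
            case 2
            then show ?thesis using diag[OF b(1)] b(2) by simp
          next
            case 3
            have "(\<Sum>i\<in>J. c i * g i j) = s j + (s a * f b j - s b * f a j) / f a b"
              by (simp add: g_def s_def distrib_left right_diff_distrib sum.distrib sum_distrib_right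
                  sum_subtractf sum_divide_distrib diff_divide_distrib mult.assoc)
            then show ?thesis using c[OF 3] by simp
          qed
        qed
        finally show "(\<Sum>i\<in>I. c' i * f i j) = 0" .
      qed (use i I in auto)
      then show "c i = 0" using i J by (auto simp: c'_def split: if_splits)
    qed (use card J in auto)
    then show ?thesis using card by simp
  qed simp
qed

text \<open>A relation between the rows of the Gram matrix of \<open>\<beta>\<close> on
  \<open>B\<close> is a vector of the span that is orthogonal to \<open>B\<close>, hence to the
  whole span.\<close>

lemma even_card_basis_skew_nondegenerate:
  fixes \<beta> :: "'a::real_vector \<Rightarrow> 'a \<Rightarrow> real"
  assumes bil: "bilinear \<beta>"
    and B: "finite B" "independent B"
    and skew: "\<And>x y. x \<in> span B \<Longrightarrow> y \<in> span B \<Longrightarrow> \<beta> y x = - \<beta> x y"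
    and nondeg: "\<And>x. x \<in> span B \<Longrightarrow> (\<And>y. y \<in> span B \<Longrightarrow> \<beta> x y = 0) \<Longrightarrow> x = 0"
  shows "even (card B)"
proof (rule even_card_skew_nondegenerate_family[where f = \<beta>])
  fix c i assume c: "\<And>j. j \<in> B \<Longrightarrow> (\<Sum>i\<in>B. c i * \<beta> i j) = 0" and i: "i \<in> B"
  define x where "x = (\<Sum>i\<in>B. c i *\<^sub>R i)"
  have lin: "linear (\<beta> x)" "linear (\<lambda>x. \<beta> x y)" for x y
    using bil by (auto simp: bilinear_def)
  have "x = 0"
  proof (rule nondeg)
    show "x \<in> span B" unfolding x_def by (intro span_sum span_scale span_base)
    fix y assume y: "y \<in> span B"
    show "\<beta> x y = 0"
    proof (rule linear_eq_0_on_span[OF lin(1) _ y])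
      fix j assume "j \<in> B"
      then show "\<beta> x j = 0"
        using c[of j] by (simp add: x_def linear_sum[OF lin(2)] linear_cmul[OF lin(2)])
    qed
  qed
  then show "c i = 0" using independentD[OF B(2,1) subset_refl] i by (auto simp: x_def)
qed (use B skew in \<open>auto intro: span_base\<close>)

text \<open>\<open>T\<close> maps the kernel of each power into the kernel of the preceding one.
  Lifting a basis of the image and adjoining generators of the kernel of \<open>T\<close> spans the
  larger kernel.\<close>

lemma kernel_funpow_finite_dimensional:
  fixes T :: "'a::real_vector \<Rightarrow> 'a"
  assumes T: "linear T" and B: "finite B" "{x. T x = 0} \<subseteq> span B"
  shows "\<exists>C. finite C \<and> {x. (T ^^ k) x = 0} \<subseteq> span C"
proof (induction k)
  case 0
  then show ?case by (intro exI[of _ "{}"]) auto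
next
  case (Suc k)
  then obtain C where C: "finite C" "{x. (T ^^ k) x = 0} \<subseteq> span C" by blast
  define V where "V = {x. (T ^^ Suc k) x = 0}"
  have TV: "T ` V \<subseteq> span C" using C(2) by (auto simp: V_def funpow_swap1)
  obtain D where D: "D \<subseteq> T ` V" "independent D" "T ` V \<subseteq> span D"
    using maximal_independent_subset by blast
  have "finite D" using independent_span_bound[OF C(1) D(2)] D(1) TV by blast
  then obtain D' where D': "D' \<subseteq> V" "finite D'" "D = T ` D'"
    using finite_subset_image D(1) by metis
  have "V \<subseteq> span (D' \<union> B)"
  proof
    fix x assume "x \<in> V"
    then have "T x \<in> T ` span D'" using D(3) linear_span_image[OF T] D'(3) by auto
    then obtain d where d: "d \<in> span D'" "T x = T d" by blast
    then have "x - d \<in> span B" using B(2) linear_diff[OF T] by auto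
    then have "x - d \<in> span (D' \<union> B)" "d \<in> span (D' \<union> B)"
      using d(1) span_mono[of B "D' \<union> B"] span_mono[of D' "D' \<union> B"] by auto
    then show "x \<in> span (D' \<union> B)" using span_add by fastforce
  qed
  then show ?case using B(1) D'(2) V_def by (metis finite_UnI)
qed

section \<open>The operator induced by a bounded bilinear form\<close>

lemma bounded_linear_L_form:
  assumes "bounded_bilinear \<omega>"
  shows "bounded_linear (L_form \<omega>)"
proof -
  interpret bounded_bilinear \<omega> by fact
  obtain K where K: "0 < K" "\<And>a b. norm (\<omega> a b) \<le> norm a * norm b * K" using pos_bounded by blast
  show ?thesis
  proof (rule bounded_linear_intro)
    show "L_form \<omega> (x + y) = L_form \<omega> x + L_form \<omega> y" for x y
      by (rule blinfun_eqI) (simp add: L_form_apply assms blinfun.add_left add_left)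
    show "L_form \<omega> (c *\<^sub>R x) = c *\<^sub>R L_form \<omega> x" for c x
      by (rule blinfun_eqI) (simp add: L_form_apply assms blinfun.scaleR_left scaleR_left)
    show "norm (L_form \<omega> x) \<le> norm x * K" for x
      using K(1) K(2)[of x] by (intro norm_blinfun_bound) (simp_all add: L_form_apply assms mult.commute mult.left_commute)
  qed
qed

lemma L_form_diff:
  assumes "bounded_bilinear \<omega>" "bounded_bilinear \<eta>"
  shows "L_form (\<lambda>x y. \<omega> x y - \<eta> x y) = (\<lambda>x. L_form \<omega> x - L_form \<eta> x)"
proof (rule ext, rule blinfun_eqI)
  fix x
  have "bounded_linear (\<lambda>y. \<omega> x y - \<eta> x y)"
    using assms by (intro bounded_linear_sub bounded_bilinear.bounded_linear_right)
  then show "L_form (\<lambda>x y. \<omega> x y - \<eta> x y) x y = (L_form \<omega> x - L_form \<eta> x) y" for y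
    by (subst L_form_def, subst bounded_linear_Blinfun_apply)
      (simp_all add: L_form_apply assms blinfun.diff_left)
qed

lemma L_form_eq_0_iff:
  assumes "bounded_bilinear \<omega>"
  shows "L_form \<omega> x = 0 \<longleftrightarrow> (\<forall>y. \<omega> x y = 0)"
  using L_form_apply[OF assms] by (metis blinfun_eqI zero_blinfun.rep_eq)

lemma inj_L_formI:
  assumes "bounded_bilinear \<omega>" "\<And>x. (\<And>y. \<omega> x y = 0) \<Longrightarrow> x = 0"
  shows "inj (L_form \<omega>)"
  using assms by (simp add: linear_injective_0 bounded_linear.linear[OF bounded_linear_L_form] L_form_eq_0_iff)

text \<open>Skew symmetry moves nondegeneracy from the second argument, where
  \<open>symplectic\<close> states it, to the first, where injectivity of \<open>L_form\<close>
  needs it.\<close>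

lemma symplectic_nondegenerate_left:
  assumes "symplectic \<omega>" "\<And>y. \<omega> x y = 0"
  shows "x = 0"
  using assms unfolding symplectic_def by (metis minus_zero)

section \<open>Parity of the kernel dimension under compact perturbation\<close>

text \<open>The coordinates of a common vector with respect to \<open>A\<close> are supported both
  inside and outside \<open>B\<close>, so they all vanish.\<close>

lemma span_Int_span_diff:
  fixes A B :: "'a::real_vector set"
  assumes "independent A" "B \<subseteq> A"
  shows "span B \<inter> span (A - B) \<subseteq> {0}"
proof
  fix x assume x: "x \<in> span B \<inter> span (A - B)"
  have "representation A x b = 0" for b
  proof -
    have "representation A x = representation B x" "representation A x = representation (A - B) x"
      using x assms by (auto intro: representation_extend)
    then show ?thesis using representation_ne_zero by (metis DiffD2)
  qed
  moreover have "x \<in> span A" using x assms(2) span_mono by blast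
  ultimately show "x \<in> {0}"
    using sum_nonzero_representation_eq[OF assms(1), of x] by simp
qed

text \<open>\<open>T\<close> represents \<open>\<Omega>0\<close> through \<open>\<Omega>\<close>, so
  its kernel is the radical of \<open>\<Omega>0\<close>, with basis \<open>B\<close>. Extending
  \<open>B\<close> to a basis \<open>A\<close> of the generalized kernel \<open>E\<close> exhibits
  \<open>card B\<close> as the difference of the even numbers \<open>card A\<close> and
  \<open>card (A - B)\<close>.\<close>

lemma even_kernel_dim_compact_perturbation:
  fixes \<Omega> \<Omega>0 :: "'a::banach \<Rightarrow> 'a \<Rightarrow> real"
  assumes strong: "strong_symplectic \<Omega>"
    and \<Omega>0: "bounded_bilinear \<Omega>0" "\<And>x y. \<Omega>0 y x = - \<Omega>0 x y"
    and cc: "completely_continuous (\<lambda>x. L_form \<Omega>0 x - L_form \<Omega> x)"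
    and B: "finite B" "independent B" "span B = {x. \<forall>y. \<Omega>0 x y = 0}"
  shows "even (card B)"
proof -
  have sympl: "symplectic \<Omega>" and bij: "bij (L_form \<Omega>)" and inv: "bounded_linear (inv (L_form \<Omega>))"
    using strong by (auto simp: strong_symplectic_def)
  have bb: "bounded_bilinear \<Omega>" and skew: "\<Omega> y x = - \<Omega> x y" for x y
    using sympl unfolding symplectic_def by blast+
  interpret \<Omega>: bounded_bilinear \<Omega> by (rule bb)
  interpret iL: bounded_linear "inv (L_form \<Omega>)" by (rule inv)
  define K where "K = (\<lambda>x. inv (L_form \<Omega>) (L_form \<Omega>0 x - L_form \<Omega> x))"
  define T where "T = (\<lambda>x. x + K x)"
  have K: "completely_continuous K"
    unfolding K_def by (rule completely_continuous_compose_left[OF inv cc])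
  then have T: "bounded_linear T"
    unfolding T_def by (rule bounded_linear_identity_plus_completely_continuous)
  have "linear T" using T by (rule bounded_linear.linear)
  have T_eq: "T x = inv (L_form \<Omega>) (L_form \<Omega>0 x)" for x
    using bij by (simp add: T_def K_def iL.diff bij_is_inj inv_f_f)
  have LT: "L_form \<Omega> (T x) = L_form \<Omega>0 x" for x
    using bij by (simp add: T_eq bij_is_surj surj_f_inv_f)
  have \<Omega>T: "\<Omega> (T x) y = \<Omega>0 x y" for x y
    using LT[of x] by (metis L_form_apply bb \<Omega>0(1))
  \<comment> \<open>Both forms are skew, so the two sign changes cancel.\<close>
  have self: "\<Omega> (T x) y = \<Omega> x (T y)" for x y
    using \<Omega>T[of x y] \<Omega>T[of y x] \<Omega>0(2)[of x y] skew[of x "T y"] by simp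
  have self_k: "\<Omega> ((T ^^ k) x) y = \<Omega> x ((T ^^ k) y)" for k x y
    by (induction k arbitrary: x y) (simp_all add: self funpow_swap1)
  have nondeg: "x = 0" if "\<And>y. \<Omega> x y = 0" for x
    using symplectic_nondegenerate_left[OF sympl that] .
  have ker: "T x = 0 \<longleftrightarrow> x \<in> span B" for x
  proof
    assume "T x = 0"
    then have "\<Omega>0 x y = 0" for y using \<Omega>T[of x y] by (simp add: \<Omega>.zero_left)
    then show "x \<in> span B" by (simp add: B(3))
  next
    assume "x \<in> span B"
    then show "T x = 0" by (intro nondeg) (simp add: \<Omega>T B(3))
  qed
  obtain M where M: "range (T ^^ M) = range (T ^^ Suc M)"
    using range_funpow_stabilizes[OF K] unfolding T_def by blast
  define N where "N = Suc M" \<comment> \<open>positive, so that the kernel of \<open>T\<close> lies in \<open>E\<close>\<close>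
  have N: "range (T ^^ (N + m)) = range (T ^^ N)" for m
    using range_funpow_stable[OF M, of "Suc m"] M by (simp add: N_def)
  define E where "E = {x. (T ^^ N) x = 0}"
  have linN: "linear (T ^^ N)" for N using bounded_linear_funpow[OF T] by (rule bounded_linear.linear)
  have E_sub: "subspace E"
    unfolding E_def using linN by (rule linear_subspace_kernel)
  \<comment> \<open>Any \<open>y\<close> is the sum of an element of \<open>E\<close> and some
    \<open>T^N z\<close>, because \<open>T^N\<close> and \<open>T^(2N)\<close> have the same range.
    The second summand is orthogonal to \<open>E\<close>, since self-adjointness moves
    \<open>T^N\<close> onto \<open>x\<close>, which it kills.\<close>
  have E_nondeg: "x = 0" if x: "x \<in> E" "\<And>y. y \<in> E \<Longrightarrow> \<Omega> x y = 0" for x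
  proof (rule nondeg)
    fix y
    have "(T ^^ N) y \<in> range (T ^^ (N + N))" using N by blast
    then obtain z where z: "(T ^^ N) y = (T ^^ N) ((T ^^ N) z)" by (auto simp: funpow_add)
    have "y - (T ^^ N) z \<in> E" by (simp add: E_def linear_diff[OF linN] z)
    then have "\<Omega> x y = \<Omega> x ((T ^^ N) z)" using x(2) by (force simp: \<Omega>.diff_right)
    also have "\<dots> = \<Omega> ((T ^^ N) x) z" by (simp add: self_k)
    also have "\<dots> = 0" using x(1) by (simp add: E_def \<Omega>.zero_left)
    finally show "\<Omega> x y = 0" .
  qed
  have TE: "T x \<in> E" if "x \<in> E" for x
    using that linear_0[OF \<open>linear T\<close>] by (simp add: E_def funpow_swap1[symmetric])
  have "\<exists>C. finite C \<and> E \<subseteq> span C"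
    unfolding E_def using ker by (intro kernel_funpow_finite_dimensional[OF \<open>linear T\<close> B(1)]) auto
  then obtain C where C: "finite C" "E \<subseteq> span C" by blast
  have BE: "B \<subseteq> E"
  proof
    fix x assume "x \<in> B"
    then have "T x = 0" using ker span_base by blast
    then show "x \<in> E" using linear_0[OF linN] by (simp add: E_def N_def funpow_swap1)
  qed
  obtain A where A: "B \<subseteq> A" "A \<subseteq> E" "independent A" "E \<subseteq> span A"
    using maximal_independent_subset_extend[OF BE B(2)] by blast
  have spanA: "span A = E"
    using A E_sub by (simp add: span_minimal subset_antisym)
  have finA: "finite A" using independent_span_bound[OF C(1) A(3)] A(2) C(2) by blast
  have "even (card A)"
  proof (rule even_card_basis_skew_nondegenerate[OF _ finA A(3)])
    show "bilinear \<Omega>"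
      unfolding bilinear_def
      using \<Omega>.bounded_linear_left \<Omega>.bounded_linear_right bounded_linear.linear by blast
    show "\<Omega> y x = - \<Omega> x y" for x y by (rule skew)
    show "x = 0" if "x \<in> span A" "\<And>y. y \<in> span A \<Longrightarrow> \<Omega> x y = 0" for x
      using that unfolding spanA by (rule E_nondeg)
  qed
  \<comment> \<open>A vector \<open>x\<close> of this complement that is
    \<open>\<Omega>0\<close>-orthogonal to the complement is so to \<open>B\<close> as well, hence
    to \<open>E\<close>. Thus \<open>T x\<close>, an element of \<open>E\<close>, is
    \<open>\<Omega>\<close>-orthogonal to \<open>E\<close> and vanishes; so \<open>x\<close> lies in
    the kernel and in its complement.\<close>
  moreover have "even (card (A - B))"
  proof (rule even_card_basis_skew_nondegenerate[where \<beta> = \<Omega>0])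
    show "bilinear \<Omega>0"
      unfolding bilinear_def using \<Omega>0(1) bounded_bilinear.bounded_linear_left
        bounded_bilinear.bounded_linear_right bounded_linear.linear by blast
    show "\<Omega>0 y x = - \<Omega>0 x y" for x y by (rule \<Omega>0(2))
    show "finite (A - B)" using finA by simp
    show "independent (A - B)" using A(3) by (rule independent_mono) auto
    fix x assume x: "x \<in> span (A - B)" and orth: "\<And>y. y \<in> span (A - B) \<Longrightarrow> \<Omega>0 x y = 0"
    have "x \<in> E" using x spanA span_mono[of "A - B" A] by blast
    have "linear (\<Omega>0 x)"
      using \<Omega>0(1) bounded_bilinear.bounded_linear_right bounded_linear.linear by blast
    have "\<Omega>0 x y = 0" if "y \<in> span A" for y
    proof (rule linear_eq_0_on_span[OF \<open>linear (\<Omega>0 x)\<close> _ that])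
      fix a assume "a \<in> A"
      show "\<Omega>0 x a = 0"
      proof (cases "a \<in> B")
        case True
        then have "\<Omega>0 a x = 0" using B(3) span_base by blast
        then show ?thesis using \<Omega>0(2)[of a x] by simp
      next
        case False
        then show ?thesis using orth \<open>a \<in> A\<close> span_base by blast
      qed
    qed
    then have "T x = 0"
      using E_nondeg[OF TE[OF \<open>x \<in> E\<close>]] spanA \<Omega>T by auto
    then have "x \<in> span B" using ker by simp
    then show "x = 0"
      using span_Int_span_diff[OF A(3,1)] x by blast
  qed
  moreover have "card A = card B + card (A - B)"
    using finA A(1) by (metis card_Diff_subset card_mono finite_subset le_add_diff_inverse)
  ultimately show ?thesis by simp
qed

section \<open>Coordinates on R^n and forms on the product\<close>

lemma bounded_linear_coord: "bounded_linear (\<lambda>v :: 'n::len0 rvec. coord v i)"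
  by (rule bounded_linear_intro[of _ 1])
    (simp_all add: plus_rvec.rep_eq scaleR_rvec.rep_eq abs_coord_le_norm)

text \<open>The bound on \<open>j\<close> keeps the function in the representing set for every
  \<open>i\<close>; an index beyond the dimension gives the zero vector.\<close>

definition rvec_axis :: "nat \<Rightarrow> 'n::len0 rvec" where
  "rvec_axis i = Rvec (\<lambda>j. of_bool (i = j \<and> j < LENGTH('n)))"

lemma coord_rvec_axis: "coord (rvec_axis i :: 'n rvec) j = of_bool (i = j \<and> j < LENGTH('n::len0))"
  unfolding rvec_axis_def by (subst Rvec_inverse) auto

lemma coord_sum_axis:
  "coord (\<Sum>i<LENGTH('n). c i *\<^sub>R (rvec_axis i :: 'n::len0 rvec)) j = of_bool (j < LENGTH('n)) * c j"
proof -
  have lin: "linear (\<lambda>v :: 'n rvec. coord v j)"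
    by (intro bounded_linear.linear bounded_linear_coord)
  have "coord (\<Sum>i<LENGTH('n). c i *\<^sub>R (rvec_axis i :: 'n rvec)) j =
      (\<Sum>i<LENGTH('n). if i = j then of_bool (j < LENGTH('n)) * c j else 0)"
    by (auto simp: linear_sum[OF lin] scaleR_rvec.rep_eq coord_rvec_axis intro: sum.cong)
  then show ?thesis by simp
qed

lemma rvec_expand:
  fixes v :: "'n::len0 rvec"
  shows "v = (\<Sum>i<LENGTH('n). coord v i *\<^sub>R rvec_axis i)"
  by (subst coord_inject[symmetric]) (auto simp: fun_eq_iff coord_sum_axis coord_eq_0)

lemma bounded_bilinear_restrict_form:
  fixes \<omega> :: "'a::real_normed_vector \<times> 'b::real_normed_vector \<Rightarrow> 'a \<times> 'b \<Rightarrow> real"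
  assumes "bounded_bilinear \<omega>"
  shows "bounded_bilinear (restrict_form \<omega>)"
  unfolding restrict_form_def
  by (intro bounded_bilinear.comp[OF assms] bounded_linear_Pair bounded_linear_ident bounded_linear_zero)

text \<open>Enlarging the space by finitely many dimensions changes the operator only by finite-rank
  terms, so compactness is decided on the first factor.\<close>

lemma completely_continuous_L_form_prod:
  fixes \<delta> :: "'a::real_normed_vector \<times> 'n::len0 rvec \<Rightarrow> 'a \<times> 'n rvec \<Rightarrow> real"
  assumes bb: "bounded_bilinear \<delta>"
    and cc: "completely_continuous (L_form (restrict_form \<delta>))"
  shows "completely_continuous (L_form \<delta>)"
proof -
  interpret bounded_bilinear \<delta> by (rule bb)
  define e :: "nat \<Rightarrow> 'a \<times> 'n rvec" where "e i = (0, rvec_axis i)" for i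
  define \<phi> :: "nat \<Rightarrow> ('a \<times> 'n rvec) \<Rightarrow>\<^sub>L real" where "\<phi> i = Blinfun (\<lambda>w. coord (snd w) i)" for i
  have cs: "bounded_linear (\<lambda>w :: 'a \<times> 'n rvec. coord (snd w) i)" for i
    by (rule bounded_linear_compose[OF bounded_linear_coord bounded_linear_snd])
  have \<phi>: "\<phi> i w = coord (snd w) i" for i w
    unfolding \<phi>_def using cs by (subst bounded_linear_Blinfun_apply) auto
  have embed: "bounded_linear (\<lambda>z :: 'a \<times> 'n rvec. (fst z, 0 :: 'n rvec))"
    by (intro bounded_linear_Pair bounded_linear_fst bounded_linear_zero)
  have expand: "z = (fst z, 0) + (\<Sum>i<LENGTH('n). coord (snd z) i *\<^sub>R e i)" for z
    using rvec_expand[of "snd z"] by (intro prod_eqI) (simp_all add: e_def fst_sum snd_sum)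
  \<comment> \<open>Block decomposition: the first factor paired with itself, the first factor
    paired with the axes, and the axes paired with everything. The last two are sums of rank-one
    maps.\<close>
  define G where "G z = blinfun_compose (L_form (restrict_form \<delta>) (fst z)) fst_blinfun
      + (\<Sum>i<LENGTH('n). \<delta> (fst z, 0) (e i) *\<^sub>R \<phi> i)
      + (\<Sum>i<LENGTH('n). coord (snd z) i *\<^sub>R L_form \<delta> (e i))" for z :: "'a \<times> 'n rvec"
  have "L_form \<delta> = G"
  proof (rule ext, rule blinfun_eqI)
    fix z w
    have "\<delta> z w = \<delta> (fst z, 0) w + (\<Sum>i<LENGTH('n). coord (snd z) i * \<delta> (e i) w)"
      by (subst expand[of z]) (simp add: add_left sum_left scaleR_left)
    also have "\<delta> (fst z, 0) w = \<delta> (fst z, 0) (fst w, 0) + (\<Sum>i<LENGTH('n). coord (snd w) i * \<delta> (fst z, 0) (e i))"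
      by (subst expand[of w]) (simp add: add_right sum_right scaleR_right)
    finally show "L_form \<delta> z w = G z w"
      by (simp add: G_def L_form_apply bb bounded_bilinear_restrict_form blinfun.add_left blinfun.sum_left blinfun.scaleR_left
          restrict_form_def \<phi> mult.commute)
  qed
  moreover have "completely_continuous G"
    unfolding G_def
  proof (intro completely_continuous_add completely_continuous_sum completely_continuous_rank_one cs)
    show "completely_continuous (\<lambda>z :: 'a \<times> 'n rvec. blinfun_compose (L_form (restrict_form \<delta>) (fst z)) fst_blinfun)"
      by (rule completely_continuous_compose_left[OF
            bounded_bilinear.bounded_linear_left[OF bounded_bilinear_blinfun_compose]
            completely_continuous_compose_right[OF cc bounded_linear_fst]])
    show "bounded_linear (\<lambda>z :: 'a \<times> 'n rvec. \<delta> (fst z, 0) (e i))" for i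
      using bounded_linear_compose[OF bounded_linear_left embed] .
  qed
  ultimately show ?thesis by simp
qed

definition sum_form :: "('a \<Rightarrow> 'a \<Rightarrow> real) \<Rightarrow> ('b \<Rightarrow> 'b \<Rightarrow> real) \<Rightarrow> 'a \<times> 'b \<Rightarrow> 'a \<times> 'b \<Rightarrow> real" where
  "sum_form \<omega> \<sigma> z w = \<omega> (fst z) (fst w) + \<sigma> (snd z) (snd w)"

lemma bounded_bilinear_add:
  assumes "bounded_bilinear f" "bounded_bilinear g"
  shows "bounded_bilinear (\<lambda>x y. f x y + g x y)"
proof -
  interpret f: bounded_bilinear f by fact
  interpret g: bounded_bilinear g by fact
  obtain F where F: "\<And>a b. norm (f a b) \<le> norm a * norm b * F" using f.bounded by blast
  obtain G where G: "\<And>a b. norm (g a b) \<le> norm a * norm b * G" using g.bounded by blast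
  show ?thesis
  proof (unfold_locales, goal_cases)
    case 5
    have "norm (f a b + g a b) \<le> norm a * norm b * (F + G)" for a b
      using norm_triangle_mono[OF F G] by (simp add: distrib_left)
    then show ?case by blast
  qed (simp_all add: f.add_left f.add_right g.add_left g.add_right f.scaleR_left f.scaleR_right
      g.scaleR_left g.scaleR_right scaleR_add_right)
qed

lemma bounded_bilinear_minus:
  assumes "bounded_bilinear f"
  shows "bounded_bilinear (\<lambda>x y. - f x y)"
proof -
  interpret f: bounded_bilinear f by fact
  show ?thesis
    using f.bounded by unfold_locales (simp_all add: f.add_left f.add_right f.scaleR_left f.scaleR_right)
qed

lemma bounded_bilinear_zero: "bounded_bilinear (\<lambda>x y. 0)"
  by unfold_locales (auto intro: exI[of _ 0])

lemma bounded_bilinear_sum: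
  "(\<And>i. i \<in> I \<Longrightarrow> bounded_bilinear (f i)) \<Longrightarrow> bounded_bilinear (\<lambda>x y. \<Sum>i\<in>I. f i x y)"
  by (induction I rule: infinite_finite_induct) (simp_all add: bounded_bilinear_zero bounded_bilinear_add)

lemma bounded_bilinear_sum_form:
  assumes "bounded_bilinear \<omega>" "bounded_bilinear \<sigma>"
  shows "bounded_bilinear (sum_form \<omega> \<sigma>)"
  unfolding sum_form_def
  by (intro bounded_bilinear_add bounded_bilinear.comp[OF assms(1)] bounded_bilinear.comp[OF assms(2)]
      bounded_linear_fst bounded_linear_snd)

definition rvec_dot :: "'n::len0 rvec \<Rightarrow> 'n rvec \<Rightarrow> real" where
  "rvec_dot u v = (\<Sum>i<LENGTH('n). coord u i * coord v i)"

lemma bounded_bilinear_rvec_dot: "bounded_bilinear (rvec_dot :: 'n::len0 rvec \<Rightarrow> _)"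
  unfolding rvec_dot_def
  by (intro bounded_bilinear_sum bounded_bilinear.comp[OF bounded_bilinear_mult] bounded_linear_coord)

lemma rvec_dot_self_eq_0: "rvec_dot u u = 0 \<Longrightarrow> u = 0"
proof -
  assume "rvec_dot u u = 0"
  then have "coord u i = 0" if "i < LENGTH('a)" for i
    using that by (auto simp: rvec_dot_def sum_nonneg_eq_0_iff)
  then have "norm u = 0"
    unfolding norm_rvec_def by (intro L2_set_eq_0_iff[THEN iffD2]) auto
  then show "u = 0" by simp
qed

text \<open>On the first factor \<open>\<sigma>\<close> contributes nothing, so the restricted
  difference is the given compact one whatever \<open>\<sigma>\<close> is. This serves both the
  inner product and the zero form.\<close>

lemma completely_continuous_sum_form_diff:
  fixes \<omega> :: "'a::banach \<Rightarrow> 'a \<Rightarrow> real"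
    and \<omega>' :: "'a \<times> 'n::len0 rvec \<Rightarrow> 'a \<times> 'n rvec \<Rightarrow> real"
  assumes \<omega>: "bounded_bilinear \<omega>" and \<omega>': "bounded_bilinear \<omega>'" and \<sigma>: "bounded_bilinear \<sigma>"
    and cc: "completely_continuous (\<lambda>x. L_form (restrict_form \<omega>') x - L_form \<omega> x)"
  shows "completely_continuous (\<lambda>z. L_form \<omega>' z - L_form (sum_form \<omega> \<sigma>) z)"
proof -
  define \<delta> where "\<delta> = (\<lambda>z w. \<omega>' z w - sum_form \<omega> \<sigma> z w)"
  have "bounded_bilinear \<delta>"
    unfolding \<delta>_def diff_conv_add_uminus
    by (intro bounded_bilinear_add \<omega>' bounded_bilinear_minus bounded_bilinear_sum_form \<omega> \<sigma>)
  moreover have "restrict_form \<delta> = (\<lambda>x y. restrict_form \<omega>' x y - \<omega> x y)"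
    using \<sigma> by (simp add: fun_eq_iff restrict_form_def \<delta>_def sum_form_def bounded_bilinear.zero_left)
  then have "L_form (restrict_form \<delta>) = (\<lambda>x. L_form (restrict_form \<omega>') x - L_form \<omega> x)"
    using L_form_diff[OF bounded_bilinear_restrict_form[OF \<omega>'] \<omega>] by (simp only:)
  ultimately have "completely_continuous (L_form \<delta>)"
    using cc by (intro completely_continuous_L_form_prod) simp_all
  moreover have "L_form \<delta> = (\<lambda>z. L_form \<omega>' z - L_form (sum_form \<omega> \<sigma>) z)"
    using L_form_diff[OF \<omega>' bounded_bilinear_sum_form[OF \<omega> \<sigma>]] by (simp only: \<delta>_def)
  ultimately show ?thesis by simp
qed

section \<open>Invertibility for the direct sum and for its first summand\<close>

text \<open>Extend a functional by zero to the second factor, invert there and project back: this is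
  a bounded right inverse of the injective \<open>L_form \<omega>\<close>, hence its
  inverse.\<close>

lemma strong_symplectic_of_sum_form:
  fixes \<omega> :: "'a::banach \<Rightarrow> 'a \<Rightarrow> real" and \<sigma> :: "'b::real_normed_vector \<Rightarrow> 'b \<Rightarrow> real"
  assumes "symplectic \<omega>" "bounded_bilinear \<sigma>"
    and L: "bij (L_form (sum_form \<omega> \<sigma>))" "bounded_linear (inv (L_form (sum_form \<omega> \<sigma>)))"
  shows "strong_symplectic \<omega>"
proof -
  have bb: "bounded_bilinear \<omega>" using assms(1) unfolding symplectic_def by blast
  have inj: "inj (L_form \<omega>)"
    using inj_L_formI[OF bb symplectic_nondegenerate_left[OF assms(1)]] by blast
  define R :: "('a \<Rightarrow>\<^sub>L real) \<Rightarrow> 'a" where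
    "R f = fst (inv (L_form (sum_form \<omega> \<sigma>)) (blinfun_compose f fst_blinfun))" for f
  have R: "bounded_linear R"
    unfolding R_def
    by (rule bounded_linear_compose[OF bounded_linear_fst bounded_linear_compose[OF L(2)
          bounded_bilinear.bounded_linear_left[OF bounded_bilinear_blinfun_compose]]])
  have LR: "L_form \<omega> (R f) = f" for f
  proof (rule blinfun_eqI)
    fix y
    define z where "z = inv (L_form (sum_form \<omega> \<sigma>)) (blinfun_compose f fst_blinfun)"
    have "L_form (sum_form \<omega> \<sigma>) z = blinfun_compose f fst_blinfun"
      unfolding z_def using L(1) by (simp add: bij_is_surj surj_f_inv_f)
    from arg_cong[OF this, of "\<lambda>g. blinfun_apply g (y, 0)"]
    show "L_form \<omega> (R f) y = f y"
      by (simp add: L_form_apply bb assms(2) bounded_bilinear_sum_form sum_form_def R_def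
          bounded_bilinear.zero_right flip: z_def)
  qed
  have "surj (L_form \<omega>)" using LR by (metis surjI)
  then have bij: "bij (L_form \<omega>)" using inj by (simp add: bij_def)
  have "inv (L_form \<omega>) = R"
    using LR inj by (metis ext inv_f_eq)
  then show ?thesis using assms(1) bij R by (simp add: strong_symplectic_def)
qed

text \<open>The inverse is explicit: on the first factor invert \<open>L_form \<omega>\<close> on
  the restricted functional; on the second, the values at the axis vectors are the coordinates of
  the vector representing the functional by the inner product.\<close>

lemma bij_L_form_sum_form_rvec_dot:
  fixes \<omega> :: "'a::banach \<Rightarrow> 'a \<Rightarrow> real"
  defines "\<eta> \<equiv> sum_form \<omega> (rvec_dot :: 'n::len0 rvec \<Rightarrow> _)"
  assumes strong: "strong_symplectic \<omega>" and inj: "inj (L_form \<eta>)"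
  shows "bij (L_form \<eta>) \<and> bounded_linear (inv (L_form \<eta>))"
proof -
  have bb: "bounded_bilinear \<omega>" and bij: "bij (L_form \<omega>)" and inv: "bounded_linear (inv (L_form \<omega>))"
    using strong unfolding strong_symplectic_def symplectic_def by blast+
  have bb_\<eta>: "bounded_bilinear \<eta>"
    unfolding \<eta>_def by (intro bounded_bilinear_sum_form bb bounded_bilinear_rvec_dot)
  have incl: "bounded_linear (\<lambda>x :: 'a. (x, 0 :: 'n rvec))"
    by (intro bounded_linear_Pair bounded_linear_ident bounded_linear_zero)
  define \<iota> where "\<iota> = Blinfun (\<lambda>x :: 'a. (x, 0 :: 'n rvec))"
  have \<iota>: "\<iota> x = (x, 0)" for x
    unfolding \<iota>_def using incl by (simp add: bounded_linear_Blinfun_apply)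
  define e :: "nat \<Rightarrow> 'a \<times> 'n rvec" where "e i = (0, rvec_axis i)" for i
  define R where "R f = (inv (L_form \<omega>) (blinfun_compose f \<iota>),
      \<Sum>i<LENGTH('n). f (e i) *\<^sub>R (rvec_axis i :: 'n rvec))" for f :: "('a \<times> 'n rvec) \<Rightarrow>\<^sub>L real"
  have R: "bounded_linear R"
    unfolding R_def
  proof (intro bounded_linear_Pair bounded_linear_sum)
    show "bounded_linear (\<lambda>f. inv (L_form \<omega>) (blinfun_compose f \<iota>))"
      by (rule bounded_linear_compose[OF inv
            bounded_bilinear.bounded_linear_left[OF bounded_bilinear_blinfun_compose]])
    show "bounded_linear (\<lambda>f :: ('a \<times> 'n rvec) \<Rightarrow>\<^sub>L real. f (e i) *\<^sub>R (rvec_axis i :: 'n rvec))" for i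
      by (rule bounded_linear_compose[OF bounded_linear_scaleR_left
            bounded_bilinear.bounded_linear_left[OF bounded_bilinear_blinfun_apply]])
  qed
  have LR: "L_form \<eta> (R f) = f" for f
  proof (rule blinfun_eqI)
    fix w :: "'a \<times> 'n rvec"
    have "\<omega> (fst (R f)) (fst w) = L_form \<omega> (inv (L_form \<omega>) (blinfun_compose f \<iota>)) (fst w)"
      by (simp add: L_form_apply bb R_def)
    also have "\<dots> = f (fst w, 0)"
      using bij by (simp add: bij_is_surj surj_f_inv_f \<iota>)
    finally have 1: "\<omega> (fst (R f)) (fst w) = f (fst w, 0)" .
    have 2: "rvec_dot (snd (R f)) (snd w) = (\<Sum>i<LENGTH('n). f (e i) * coord (snd w) i)"
      by (simp add: rvec_dot_def R_def coord_sum_axis)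
    have w: "w = (fst w, 0) + (\<Sum>i<LENGTH('n). coord (snd w) i *\<^sub>R e i)"
      using rvec_expand[of "snd w"] by (intro prod_eqI) (simp_all add: e_def fst_sum snd_sum)
    have "f w = f (fst w, 0) + (\<Sum>i<LENGTH('n). coord (snd w) i * f (e i))"
      by (subst w) (simp add: blinfun.add_right blinfun.sum_right blinfun.scaleR_right)
    then show "L_form \<eta> (R f) w = f w"
      by (simp add: L_form_apply bb_\<eta>) (simp add: \<eta>_def sum_form_def 1 2 mult.commute)
  qed
  have "surj (L_form \<eta>)" using LR by (metis surjI)
  moreover have "inv (L_form \<eta>) = R"
    using LR inj by (metis ext inv_f_eq)
  ultimately show ?thesis using inj R by (simp add: bij_def)
qed

text \<open>Supplies a basis of the radical in the parity argument; in dimension zero it is the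
  empty set.\<close>

lemma rvec_axis_basis:
  fixes B :: "('a::real_vector \<times> 'n::len0 rvec) set"
  defines "B \<equiv> (\<lambda>i. (0, rvec_axis i)) ` {..<LENGTH('n)}"
  shows "card B = LENGTH('n)" "independent B" "span B = {0} \<times> UNIV"
proof -
  have inj: "inj_on (\<lambda>i. (0 :: 'a, rvec_axis i :: 'n rvec)) {..<LENGTH('n)}"
  proof (rule inj_onI)
    fix i j assume "i \<in> {..<LENGTH('n)}" "(0 :: 'a, rvec_axis i :: 'n rvec) = (0, rvec_axis j)"
    \<comment> \<open>The range of \<open>i\<close> matters here: its axis vector has a coordinate
      equal to 1, so it is not the default zero vector.\<close>
    then have "coord (rvec_axis j :: 'n rvec) i = 1"
      using coord_rvec_axis[of i i, where 'n = 'n] by simp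
    then show "i = j" by (simp add: coord_rvec_axis split: if_splits)
  qed
  then show "card B = LENGTH('n)" by (simp add: B_def card_image)
  have sum_eq: "(\<Sum>i<LENGTH('n). c i *\<^sub>R (0 :: 'a, rvec_axis i :: 'n rvec)) = (0, \<Sum>i<LENGTH('n). c i *\<^sub>R rvec_axis i)" for c
    by (intro prod_eqI) (simp_all add: fst_sum snd_sum)
  show "independent B"
  proof (rule independent_if_scalars_zero)
    fix f and x :: "'a \<times> 'n rvec" assume f: "(\<Sum>x\<in>B. f x *\<^sub>R x) = 0" and "x \<in> B"
    then obtain j where j: "j < LENGTH('n)" "x = (0, rvec_axis j)" by (auto simp: B_def)
    have "(\<Sum>i<LENGTH('n). f (0, rvec_axis i) *\<^sub>R (rvec_axis i :: 'n rvec)) = 0"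
      using f unfolding B_def sum.reindex[OF inj] comp_def sum_eq by (simp add: zero_prod_def)
    then have "coord (\<Sum>i<LENGTH('n). f (0, rvec_axis i) *\<^sub>R (rvec_axis i :: 'n rvec)) j = 0"
      by (simp add: zero_rvec.rep_eq)
    then show "f x = 0" using j by (simp add: coord_sum_axis)
  qed (simp add: B_def)
  show "span B = {0} \<times> UNIV"
  proof
    show "span B \<subseteq> {0} \<times> UNIV"
      by (rule span_minimal) (auto simp: B_def subspace_def zero_prod_def)
    show "{0} \<times> UNIV \<subseteq> span B"
    proof
      fix z :: "'a \<times> 'n rvec" assume "z \<in> {0} \<times> UNIV"
      then have "z = (\<Sum>i<LENGTH('n). coord (snd z) i *\<^sub>R (0, rvec_axis i))"
        unfolding sum_eq using rvec_expand[of "snd z"] by auto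
      moreover have "\<dots> \<in> span B"
        by (intro span_sum span_scale span_base) (simp add: B_def)
      ultimately show "z \<in> span B" by simp
    qed
  qed
qed

lemma completely_continuous_diff_commute:
  assumes "completely_continuous (\<lambda>x. f x - g x)"
  shows "completely_continuous (\<lambda>x. g x - f x)"
  using completely_continuous_compose_left[OF bounded_linear_minus[OF bounded_linear_ident] assms]
  by simp

section \<open>Transfer of strongness and parity of n\<close>

theorem corollary1p5:
  fixes \<omega> :: "'a::banach \<Rightarrow> 'a \<Rightarrow> real"
    and \<omega>' :: "'a \<times> 'n::len0 rvec \<Rightarrow> 'a \<times> 'n rvec \<Rightarrow> real"
  assumes "symplectic \<omega>"
    and "symplectic \<omega>'"
    and "compact_operator (\<lambda>x. L_form (restrict_form \<omega>') x - L_form \<omega> x)"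
  shows "(strong_symplectic \<omega> \<longleftrightarrow> strong_symplectic \<omega>') \<and>
         (strong_symplectic \<omega> \<and> strong_symplectic \<omega>' \<longrightarrow> even LENGTH('n))"
proof -
  define \<eta> :: "'a \<times> 'n rvec \<Rightarrow> 'a \<times> 'n rvec \<Rightarrow> real" where "\<eta> = sum_form \<omega> rvec_dot"
  have bb: "bounded_bilinear \<omega>" "bounded_bilinear \<omega>'"
    using assms unfolding symplectic_def by blast+
  have bb_\<eta>: "bounded_bilinear \<eta>"
    unfolding \<eta>_def by (intro bounded_bilinear_sum_form bb bounded_bilinear_rvec_dot)
  interpret \<omega>: bounded_bilinear \<omega> by (rule bb)
  interpret dot: bounded_bilinear "rvec_dot :: 'n rvec \<Rightarrow> _" by (rule bounded_bilinear_rvec_dot)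
  \<comment> \<open>The form on R^n is left open, to be instantiated by the inner product for the
    equivalence and by zero for the parity.\<close>
  note cc = completely_continuous_sum_form_diff[OF bb _ compact_operator_imp_completely_continuous[OF assms(3)]]
  have cc_\<eta>: "completely_continuous (\<lambda>z. L_form \<omega>' z - L_form \<eta> z)"
    unfolding \<eta>_def by (rule cc[OF bounded_bilinear_rvec_dot])
  have inj_\<omega>': "inj (L_form \<omega>')"
    using inj_L_formI[OF bb(2) symplectic_nondegenerate_left[OF assms(2)]] by blast
  \<comment> \<open>Testing against \<open>(y, 0)\<close> uses nondegeneracy of
    \<open>\<omega>\<close>; testing against \<open>(0, snd z)\<close> uses positive definiteness of
    the inner product.\<close>
  have inj_\<eta>: "inj (L_form \<eta>)"
  proof (rule inj_L_formI[OF bb_\<eta>])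
    fix z :: "'a \<times> 'n rvec" assume z: "\<And>w. \<eta> z w = 0"
    have "\<omega> (fst z) y = 0" for y
      using z[of "(y, 0)"] by (simp add: \<eta>_def sum_form_def dot.zero_right)
    moreover have "rvec_dot (snd z) (snd z) = 0"
      using z[of "(0, snd z)"] by (simp add: \<eta>_def sum_form_def \<omega>.zero_right)
    ultimately show "z = 0"
      using symplectic_nondegenerate_left[OF assms(1)] rvec_dot_self_eq_0 by (intro prod_eqI) auto
  qed
  \<comment> \<open>The Fredholm alternative is applied twice with the roles of
    \<open>\<eta>\<close> and \<open>\<omega>'\<close> exchanged; both operators are injective and
    the compact difference only changes sign.\<close>
  have "bij (L_form \<eta>) \<and> bounded_linear (inv (L_form \<eta>)) \<longleftrightarrow> strong_symplectic \<omega>'"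
    unfolding strong_symplectic_def
    using Fredholm_alternative[OF bounded_linear_L_form[OF bb_\<eta>] _ _
        bounded_linear_L_form[OF bb(2)] inj_\<omega>' cc_\<eta>]
      Fredholm_alternative[OF bounded_linear_L_form[OF bb(2)] _ _ bounded_linear_L_form[OF bb_\<eta>] inj_\<eta>
        completely_continuous_diff_commute[OF cc_\<eta>]] assms(2)
    by blast
  moreover have "strong_symplectic \<omega>"
    if "bij (L_form \<eta>)" "bounded_linear (inv (L_form \<eta>))"
    using strong_symplectic_of_sum_form[OF assms(1) bounded_bilinear_rvec_dot that[unfolded \<eta>_def]] .
  moreover have "bij (L_form \<eta>) \<and> bounded_linear (inv (L_form \<eta>))" if "strong_symplectic \<omega>"
    using bij_L_form_sum_form_rvec_dot[OF that] inj_\<eta> unfolding \<eta>_def by blast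
  moreover have "even LENGTH('n)" if "strong_symplectic \<omega>'"
  proof -
    define \<omega>0 :: "'a \<times> 'n rvec \<Rightarrow> 'a \<times> 'n rvec \<Rightarrow> real" where "\<omega>0 = sum_form \<omega> (\<lambda>_ _. 0)"
    have skew: "\<omega> y x = - \<omega> x y" for x y using assms(1) unfolding symplectic_def by blast
    have "even (card ((\<lambda>i. (0 :: 'a, rvec_axis i :: 'n rvec)) ` {..<LENGTH('n)}))"
    proof (rule even_kernel_dim_compact_perturbation[OF that])
      show "bounded_bilinear \<omega>0"
        unfolding \<omega>0_def by (intro bounded_bilinear_sum_form bb bounded_bilinear_zero)
      show "\<omega>0 y x = - \<omega>0 x y" for x y
        using skew[of "fst y" "fst x"] by (simp add: \<omega>0_def sum_form_def)
      show "completely_continuous (\<lambda>x. L_form \<omega>0 x - L_form \<omega>' x)"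
        unfolding \<omega>0_def by (rule completely_continuous_diff_commute[OF cc[OF bounded_bilinear_zero]])
      \<comment> \<open>Pairing with vectors \<open>(y, 0)\<close> reduces the radical of
        \<open>\<omega>0\<close> to that of \<open>\<omega>\<close>, leaving exactly the factor
        R^n.\<close>
      have "fst x = 0" if "\<And>y. \<omega>0 x y = 0" for x
        using that[of "(_, 0)"] symplectic_nondegenerate_left[OF assms(1), of "fst x"]
        by (simp add: \<omega>0_def sum_form_def)
      then show "span ((\<lambda>i. (0, rvec_axis i)) ` {..<LENGTH('n)}) = {x. \<forall>y. \<omega>0 x y = 0}"
        unfolding rvec_axis_basis by (force simp: \<omega>0_def sum_form_def \<omega>.zero_left)
    qed (use rvec_axis_basis in auto)
    then show ?thesis by (simp only: rvec_axis_basis)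
  qed
  ultimately show ?thesis by blast
qed

end
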